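(* Let $n>2$, let $(G,f)$ be an $n$-ary group, let $e\in G$ be a fixed element, and let $\hat{G}=Ret_e(G,f)$ be the retract group. Let $V$ be a $\hat{G}$-module, with action written $x.v$ ($x\in G$, $v\in V$). Then $V$ (with the same action $x.v$) is a $G$-module if and only if for all $x_2,\ldots,x_{n-1}\in G$ and all $v\in V$ $$f(\overline{e},x_2,\ldots,x_{n-1},\overline{e}).v=x_2.(x_3.(\ldots(x_{n-1}.v)\ldots)).$$
   Context: An $n$-ary group ($n>2$) is a non-empty set $G$ with an operation $f:G^n\to G$ that is associative, i.e. $f(x_1,\ldots,x_{i-1},f(x_i,\ldots,x_{n+i-1}),x_{n+i},\ldots,x_{2n-1})$ does not depend on $i\in\{1,\ldots,n\}$, and such that for every $i$ the equation $f(x_1,\ldots,x_{i-1},z,x_{i+1},\ldots,x_n)=x_0$ has a unique solution $z\in G$ for all given elements. The symbol $\stackrel{(t)}{x}$ denotes $x$ repeated $t$ times (empty if $t=0$). The skew element $\overline{x}$ of $x$ is the unique $z$ with $f(\stackrel{(n-1)}{x},z)=x$. The retract $Ret_e(G,f)$ is the set $G$ with the binary operation $x\ast y=f(x,\stackrel{(n-2)}{e},y)$; it is a group with identity $\overline{e}$. All vector spaces are finite dimensional over $\mathbb{C}$. A $\hat G$-module is an ordinary (linear, unital) module for the group $\hat G$, so $(x\ast y).v=x.(y.v)$ and $\overline{e}.v=v$. An $n$-ary group $(G,f)$ acts on a non-empty set $A$ if to all $x\in G$, $a\in A$ there corresponds a unique element $x.a\in A$ such that (i) $f(x_1,\ldots,x_n).a=x_1.(x_2.(\ldots(x_n.a)\ldots))$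 for all $x_1,\ldots,x_n\in G$; (ii) for each $a\in A$ there is $x\in G$ with $x.a=a$; (iii) for each $x\in G$ the map $a\mapsto x.a$ is a bijection. A $G$-module is a vector space $V$ on which $G$ acts such that $x.(\lambda v+u)=\lambda (x.v)+x.u$ for all $x\in G$, scalars $\lambda$, $u,v\in V$, and there exists $p\in G$ with $p.v=v$ for all $v\in V$. *)

theory Defs
  imports Complex_Main "HOL-Algebra.Group"
begin

text \<open>An \<open>n\<close>-ary operation on \<open>G\<close> is a function on lists, of which only the values on
  lists of length \<open>n\<close> over \<open>G\<close> matter. In \<open>nary_assoc\<close> and \<open>nary_solvable\<close>
  the positions are counted from 0.\<close>

locale nary_group =
  fixes n :: nat and G :: "'a set" and f :: "'a list \<Rightarrow> 'a"
  assumes arity: "n > 2"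
    and nonempty: "G \<noteq> {}"
    and nary_closed: "\<lbrakk>length xs = n; set xs \<subseteq> G\<rbrakk> \<Longrightarrow> f xs \<in> G"
    and nary_assoc: "\<lbrakk>length xs = 2 * n - 1; set xs \<subseteq> G; i < n; j < n\<rbrakk> \<Longrightarrow>
          f (take i xs @ [f (take n (drop i xs))] @ drop (i + n) xs) =
          f (take j xs @ [f (take n (drop j xs))] @ drop (j + n) xs)"
    and nary_solvable: "\<lbrakk>length xs = n; set xs \<subseteq> G; i < n; x0 \<in> G\<rbrakk> \<Longrightarrow>
          \<exists>!z. z \<in> G \<and> f (xs[i := z]) = x0"

definition skew :: "nat \<Rightarrow> 'a set \<Rightarrow> ('a list \<Rightarrow> 'a) \<Rightarrow> 'a \<Rightarrow> 'a" where
  "skew n G f x = (THE z. z \<in> G \<and> f (replicate (n - 1) x @ [z]) = x)"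

definition retract :: "nat \<Rightarrow> 'a set \<Rightarrow> ('a list \<Rightarrow> 'a) \<Rightarrow> 'a \<Rightarrow> 'a monoid" where
  "retract n G f e =
     \<lparr>carrier = G, mult = (\<lambda>x y. f ([x] @ replicate (n - 2) e @ [y])), one = skew n G f e\<rparr>"

text \<open>A vector space is the whole type \<open>'v\<close> with scalar multiplication \<open>scale\<close>.\<close>

locale findim_complex_space = vector_space scale
  for scale :: "complex \<Rightarrow> 'v::ab_group_add \<Rightarrow> 'v" +
  assumes findim: "\<exists>Basis. finite_dimensional_vector_space scale Basis"

locale linear_group_module = group H + findim_complex_space scale
  for H :: "'a monoid" (structure)
    and scale :: "complex \<Rightarrow> 'v::ab_group_add \<Rightarrow> 'v" +
  fixes act :: "'a \<Rightarrow> 'v \<Rightarrow> 'v"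
  assumes act_linear: "x \<in> carrier H \<Longrightarrow> Vector_Spaces.linear scale scale (act x)"
    and act_mult: "\<lbrakk>x \<in> carrier H; y \<in> carrier H\<rbrakk> \<Longrightarrow> act (x \<otimes> y) v = act x (act y v)"
    and act_one: "act \<one> v = v"

text \<open>\<open>foldr act [x\<^sub>1, \<dots>, x\<^sub>k] a\<close> is \<open>x\<^sub>1.(x\<^sub>2.(\<dots>(x\<^sub>k.a)\<dots>))\<close>.\<close>

locale nary_action = nary_group n G f
  for n :: nat and G :: "'a set" and f :: "'a list \<Rightarrow> 'a" +
  fixes A :: "'b set" and act :: "'a \<Rightarrow> 'b \<Rightarrow> 'b"
  assumes A_nonempty: "A \<noteq> {}"
    and act_nary: "\<lbrakk>length xs = n; set xs \<subseteq> G; a \<in> A\<rbrakk> \<Longrightarrow> act (f xs) a = foldr act xs a"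
    and act_fix: "a \<in> A \<Longrightarrow> \<exists>x\<in>G. act x a = a"
    and act_bij: "x \<in> G \<Longrightarrow> bij_betw (act x) A A"

locale nary_module = nary_action n G f UNIV act + findim_complex_space scale
  for n :: nat and G :: "'a set" and f :: "'a list \<Rightarrow> 'a"
    and scale :: "complex \<Rightarrow> 'v::ab_group_add \<Rightarrow> 'v" and act :: "'a \<Rightarrow> 'v \<Rightarrow> 'v" +
  assumes act_lin: "x \<in> G \<Longrightarrow> act x (scale c v + u) = scale c (act x v) + act x u"
    and act_unit: "\<exists>p\<in>G. \<forall>v. act p v = v"

context nary_group
begin

lemma skew_ex1:
  assumes "x \<in> G"
  shows "\<exists>!z. z \<in> G \<and> f (replicate (n - 1) x @ [z]) = x"
proof -
  have "(replicate (n - 1) x @ [x])[n - 1 := z] = replicate (n - 1) x @ [z]" for z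
    by (simp add: list_update_append)
  moreover have "\<exists>!z. z \<in> G \<and> f ((replicate (n - 1) x @ [x])[n - 1 := z]) = x"
    by (rule nary_solvable) (use assms arity in auto)
  ultimately show ?thesis by simp
qed

lemma skew_closed: "x \<in> G \<Longrightarrow> skew n G f x \<in> G"
  and skew_eq: "x \<in> G \<Longrightarrow> f (replicate (n - 1) x @ [skew n G f x]) = x"
  unfolding skew_def using theI'[OF skew_ex1] by blast+

lemma group_retract:
  assumes e: "e \<in> G"
  shows "group (retract n G f e)"
proof -
  define m where "m x y = f (x # replicate (n - 2) e @ [y])" for x y
  define u where "u = skew n G f e"
  have u: "u \<in> G" using e skew_closed u_def by simp
  have m: "m x y \<in> G" if "x \<in> G" "y \<in> G" for x y
    unfolding m_def by (rule nary_closed) (use that e arity in auto)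
  have assoc: "m (m x y) z = m x (m y z)" if "x \<in> G" "y \<in> G" "z \<in> G" for x y z
  proof -
    let ?r = "replicate (n - 2) e"
    let ?xs = "(x # ?r) @ (y # ?r) @ [z]"
    have k: "n = Suc (Suc (n - 2))" using arity by simp
    have eq: "f (take 0 ?xs @ [f (take n (drop 0 ?xs))] @ drop (0 + n) ?xs) =
      f (take (n - 1) ?xs @ [f (take n (drop (n - 1) ?xs))] @ drop (n - 1 + n) ?xs)"
      by (rule nary_assoc) (use that e arity in auto)
    obtain k where k: "n = Suc (Suc k)" using k by blast
    show ?thesis using eq by (simp add: m_def k)
  qed
  have rsol: "\<exists>!z. z \<in> G \<and> m x z = y" if "x \<in> G" "y \<in> G" for x y
  proof -
    have "(x # replicate (n - 2) e @ [x])[n - 1 := z] = x # replicate (n - 2) e @ [z]" for z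
    proof -
      obtain k where "n = Suc (Suc k)" using arity by (metis less_imp_Suc_add add_2_eq_Suc plus_nat.simps(2))
      then show ?thesis by (simp add: list_update_append)
    qed
    moreover have "\<exists>!z. z \<in> G \<and> f ((x # replicate (n - 2) e @ [x])[n - 1 := z]) = y"
      by (rule nary_solvable) (use that e arity in auto)
    ultimately show ?thesis by (simp add: m_def)
  qed
  have lsol: "\<exists>z. z \<in> G \<and> m z x = y" if "x \<in> G" "y \<in> G" for x y
  proof -
    have "\<exists>!z. z \<in> G \<and> f ((x # replicate (n - 2) e @ [x])[0 := z]) = y"
      by (rule nary_solvable) (use that e arity in auto)
    then show ?thesis by (auto simp: m_def)
  qed
  have "replicate (n - 1) e = e # replicate (n - 2) e"
    using arity by (metis Suc_diff_Suc Suc_lessD numeral_2_eq_2 replicate_Suc One_nat_def)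
  then have eu: "m e u = e"
    using skew_eq[OF e] by (simp add: m_def u_def)
  have ru: "m x u = x" if x: "x \<in> G" for x
    using lsol[OF e x] assoc eu e u by metis
  have lu: "m u x = x" if x: "x \<in> G" for x
    using rsol[OF e m[OF e x]] assoc[OF e u x] eu m[OF u x] x by auto
  show ?thesis
  proof (rule groupI)
    fix x assume "x \<in> carrier (retract n G f e)"
    then show "\<exists>y\<in>carrier (retract n G f e). y \<otimes>\<^bsub>retract n G f e\<^esub> x = \<one>\<^bsub>retract n G f e\<^esub>"
      using lsol[OF _ u] by (auto simp: retract_def m_def u_def)
  qed (use m assoc u lu in \<open>auto simp: retract_def m_def u_def\<close>)
qed

end

end

theory Submission
  imports Defs
begin

text \<open>Write \<open>u\<close> for the skew element of \<open>e\<close>, which is the identity of the retract, and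
  \<open>\<cdot>\<close> for multiplication in the retract. The \<open>n\<close>-ary operation is recovered from the retract
  by \<open>f(x, xs, y) = x \<cdot> f(u, xs, u) \<cdot> y\<close> (lemma \<open>nary_group.nary_eq_retract_mult\<close>).
  A module over the retract turns the two outer products into compositions, so
  \<open>f(x, xs, y)\<close> acts as the composition of its arguments as soon as \<open>f(u, xs, u)\<close> acts as the
  composition of \<open>xs\<close>. Conversely, \<open>u\<close> acts as the identity, so the two
  copies of \<open>u\<close> disappear when axiom (i) of an \<open>n\<close>-ary action is applied to \<open>f(u, xs, u)\<close>.
  The remaining axioms of a module over the \<open>n\<close>-ary group are immediate: a group acts by
  bijections, and \<open>u\<close> fixes every vector.\<close>

context nary_group
begin

lemma assoc_first_last:
  assumes "length xs = n - 1" "length ys = n - 1" "set xs \<subseteq> G" "set ys \<subseteq> G" "z \<in> G"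
  shows "f (f (xs @ [z]) # ys) = f (xs @ [f (z # ys)])"
proof -
  let ?l = "xs @ z # ys"
  obtain k where k: "n = Suc k" using arity by (cases n) auto
  have "f (take 0 ?l @ [f (take n (drop 0 ?l))] @ drop (0 + n) ?l) =
      f (take (n - 1) ?l @ [f (take n (drop (n - 1) ?l))] @ drop (n - 1 + n) ?l)"
    by (rule nary_assoc) (use assms arity in auto)
  then show ?thesis using assms by (simp add: k)
qed

text \<open>Replace the outer arguments by \<open>x = f(x, e, \<dots>, e, u)\<close> and \<open>y = f(u, e, \<dots>, e, y)\<close>;
  associativity then moves the copies of \<open>u\<close> next to \<open>xs\<close>.\<close>

lemma nary_eq_retract_mult:
  assumes e: "e \<in> G" and x: "x \<in> G" and y: "y \<in> G"
    and xs: "length xs = n - 2" "set xs \<subseteq> G"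
  defines "u \<equiv> skew n G f e"
  shows "f (x # xs @ [y]) =
    x \<otimes>\<^bsub>retract n G f e\<^esub> (f (u # xs @ [u]) \<otimes>\<^bsub>retract n G f e\<^esub> y)"
proof -
  let ?es = "replicate (n - 2) e"
  interpret R: group "retract n G f e" using group_retract[OF e] .
  have u: "u \<in> G" using skew_closed[OF e] by (simp add: u_def)
  have xu: "f (x # ?es @ [u]) = x"
    using R.r_one[of x] x by (simp add: retract_def u_def)
  have uy: "f (u # ?es @ [y]) = y"
    using R.l_one[of y] y by (simp add: retract_def u_def)
  have "f (x # xs @ [y]) = f (f ((x # ?es) @ [u]) # (xs @ [y]))"
    using xu by simp
  also have "\<dots> = f ((x # ?es) @ [f (u # (xs @ [y]))])"
    by (rule assoc_first_last) (use assms u arity in auto)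
  also have "f (u # (xs @ [y])) = f ((u # xs) @ [f (u # (?es @ [y]))])"
    using uy by simp
  also have "\<dots> = f (f ((u # xs) @ [u]) # (?es @ [y]))"
    by (rule assoc_first_last[symmetric]) (use assms u arity in auto)
  finally show ?thesis by (simp add: retract_def)
qed

end

lemma (in linear_group_module) act_bij_betw:
  assumes x: "x \<in> carrier H"
  shows "bij_betw (act x) UNIV UNIV"
proof -
  have "act (inv x) (act x v) = v" "act x (act (inv x) v) = v" for v
    using x act_mult[of "inv x" x v] act_mult[of x "inv x" v] by (simp_all add: act_one)
  then show ?thesis
    by (intro bij_betw_byWitness[where f' = "act (inv x)"]) auto
qed

theorem proposition3p9:
  fixes n :: nat and G :: "'a set" and f :: "'a list \<Rightarrow> 'a" and e :: 'a
    and scale :: "complex \<Rightarrow> 'v::ab_group_add \<Rightarrow> 'v" and act :: "'a \<Rightarrow> 'v \<Rightarrow> 'v"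
  assumes "nary_group n G f"
    and "e \<in> G"
    and "linear_group_module (retract n G f e) scale act"
  shows "nary_module n G f scale act \<longleftrightarrow>
    (\<forall>xs v. length xs = n - 2 \<and> set xs \<subseteq> G \<longrightarrow>
      act (f ([skew n G f e] @ xs @ [skew n G f e])) v = foldr act xs v)"
proof -
  interpret nary_group n G f by fact
  interpret M: linear_group_module "retract n G f e" scale act by fact
  define u where "u = skew n G f e"
  have u: "u \<in> G" using skew_closed[OF assms(2)] by (simp add: u_def)
  have carrier: "carrier (retract n G f e) = G" by (simp add: retract_def)
  have act_u: "act u v = v" for v
    using M.act_one by (simp add: retract_def u_def)
  show ?thesis
    unfolding u_def[symmetric]
  proof (intro iffI allI impI)
    fix xs v
    assume "nary_module n G f scale act" and xs: "length xs = n - 2 \<and> set xs \<subseteq> G"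
    then interpret N: nary_module n G f scale act by simp
    have "act (f ([u] @ xs @ [u])) v = foldr act ([u] @ xs @ [u]) v"
      by (rule N.act_nary) (use xs u arity in auto)
    then show "act (f ([u] @ xs @ [u])) v = foldr act xs v"
      by (simp add: act_u)
  next
    assume middle: "\<forall>xs v. length xs = n - 2 \<and> set xs \<subseteq> G \<longrightarrow>
      act (f ([u] @ xs @ [u])) v = foldr act xs v"
    have act_nary: "act (f ws) v = foldr act ws v"
      if ws: "length ws = n" "set ws \<subseteq> G" for ws v
    proof -
      obtain x zs where zs: "ws = x # zs" "zs \<noteq> []"
        using ws arity by (cases ws) (auto, fastforce)
      obtain xs y where "zs = xs @ [y]"
        using zs(2) by (cases zs rule: rev_cases) auto
      with zs have split: "ws = x # xs @ [y]" by simp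
      have xs: "length xs = n - 2" "set xs \<subseteq> G" and xy: "x \<in> G" "y \<in> G"
        using ws split by auto
      let ?m = "f (u # xs @ [u])"
      have m: "?m \<in> G"
        by (rule nary_closed) (use xs u arity in auto)
      have "act (f ws) v = act x (act ?m (act y v))"
        using nary_eq_retract_mult[OF assms(2) xy xs] M.m_closed[of ?m y] xy m
        by (simp add: split M.act_mult carrier flip: u_def)
      also have "act ?m (act y v) = foldr act xs (act y v)"
        using middle xs by simp
      finally show ?thesis by (simp add: split)
    qed
    show "nary_module n G f scale act"
    proof unfold_locales
      fix x c v w
      assume "x \<in> G"
      then interpret L: Vector_Spaces.linear scale scale "act x"
        using M.act_linear carrier by simp
      show "act x (scale c v + w) = scale c (act x v) + act x w"
        by (simp add: L.add L.scale)
    qed (use u act_u act_nary M.act_bij_betw carrier in auto)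
  qed
qed

end
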